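(* Let $1\le i\le n$, $\ell\ge1$ and let $\Lambda=\sum_{j\in I}a_j\Lambda_j\in P^+_\ell$, identified with the tuple $(a_0,a_1,\dots,a_n)$. Let $\Lambda_{(0)},\Lambda_{(1)},\Lambda_{(2)},\dots$ be the sequence of weights in $P^+_\ell$ defined from the perfect crystal $B^{i,\ell}$ of type $A_n^{(1)}$ by $\Lambda_{(0)}=\Lambda$ and $\Lambda_{(k+1)}=\sum_{j\in I}\epsilon_j(b^{\Lambda_{(k)}})\Lambda_j$. Then $\Lambda_{(0)}=(a_0,\dots,a_n)$, $\Lambda_{(1)}=(a_i,a_{i+1},\dots,a_n,a_0,\dots,a_{i-1})$, and in general $\Lambda_{(k+1)}$ arises from $\Lambda_{(k)}=(c_0,\dots,c_n)$ by cutting the tuple into $(c_0,\dots,c_{i-1})$ and $(c_i,\dots,c_n)$ and gluing both pieces in reverse order: $\Lambda_{(k+1)}=(c_i,\dots,c_n,c_0,\dots,c_{i-1})$. The ground-state path of weight $\Lambda$ in $B^{i,\ell}$ is $\mathbf p_\Lambda=\cdots\otimes b_k\otimes b_{k-1}\otimes\cdots\otimes b_0$ with $b_k=b^{\Lambda_{(k)}}$, where for $\Lambda_{(k)}=(c_0,\dots,c_n)$ the element $b^{\Lambda_{(k)}}$ is the array with entries $(b^{\Lambda_{(k)}})_{p,q}=c_{(p+q)\bmod(n+1)}$ for $1\le p\le i\le q\le n$ (residue taken in $\{0,\dots,n\}$).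
   Context: Let $n\ge1$, $I=\{0,1,\dots,n\}$, $\mathfrak g$ of affine type $A_n^{(1)}$ with fundamental weights $\Lambda_0,\dots,\Lambda_n$. $P^+_\ell$ is the set of weights $\sum_{j\in I}a_j\Lambda_j$ with $a_j\in\mathbb Z_{\ge0}$ and $\sum_ja_j=\ell$. The crystal $B^{i,\ell}$ is the set of arrays $A=(a_{p,q})_{1\le p\le i,\ i\le q\le n}$ of non-negative integers ($p$ column index, $q$ row index) such that $\sum_{s=1}^n a_{\beta(s)}\le\ell$ for every sequence $(\beta(1),\dots,\beta(n))$ with $\beta(1)=(1,i)$, $\beta(n)=(i,n)$ and such that $\beta(s)=(p,q)$ implies $\beta(s+1)\in\{(p,q+1),(p+1,q)\}$. For $l>i$ let $F_l(p)=\sum_{j=1}^p a_{j,l-1}+\sum_{j=p}^i a_{j,l}$ ($1\le p\le i$), and let $p^l_+(A)$ (resp. $q^l_+(A)$) be the smallest (resp. largest) $p$ at which $F_l$ attains its maximum. For $1\le l<i$ let $G_l(p)=\sum_{j=i}^p a_{l,j}+\sum_{j=p}^n a_{l+1,j}$ ($i\le p\le n$), and let $p^l_-(A)$ (resp. $q^l_-(A)$) be the largest (resp. smallest) $p$ at which $G_l$ attains its maximum. The maps $\varphi_l,\epsilon_l$ ($l\in I$) are $\varphi_i(A)=\ell-\sum_{j=1}^{i-1}a_{j,i}-\sum_{j=i}^n a_{i,j}$; $\varphi_l(A)=\sum_{j=1}^{p^l_+(A)}a_{j,l-1}-\sum_{j=1}^{p^l_+(A)-1}a_{j,l}$ for $l>i$;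 $\varphi_l(A)=\sum_{j=p^l_-(A)}^n a_{l+1,j}-\sum_{j=p^l_-(A)+1}^n a_{l,j}$ for $1\le l<i$; $\varphi_0(A)=a_{1,n}$; $\epsilon_i(A)=a_{i,i}$; $\epsilon_l(A)=\sum_{j=q^l_+(A)}^i a_{j,l}-\sum_{j=q^l_+(A)+1}^i a_{j,l-1}$ for $l>i$; $\epsilon_l(A)=\sum_{j=i}^{q^l_-(A)}a_{l,j}-\sum_{j=i}^{q^l_-(A)-1}a_{l+1,j}$ for $1\le l<i$; $\epsilon_0(A)=\ell-\sum_{j=i}^n a_{1,j}-\sum_{j=2}^i a_{j,n}$. $B^{i,\ell}$ is a perfect crystal of level $\ell$; in particular for each $\Lambda\in P^+_\ell$ there is a unique element $b^\Lambda\in B^{i,\ell}$ with $\sum_{j\in I}\varphi_j(b^\Lambda)\Lambda_j=\Lambda$. The ground-state path of weight $\Lambda$ is by definition the sequence $\mathbf p_\Lambda=(b_k)_{k\ge0}=\cdots\otimes b_k\otimes b_{k-1}\otimes\cdots\otimes b_0$ with $b_k=b^{\Lambda_{(k)}}$, where $\Lambda_{(0)}=\Lambda$ and $\Lambda_{(k+1)}=\sum_{j\in I}\epsilon_j(b^{\Lambda_{(k)}})\Lambda_j$. *)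

theory Defs
  imports Main
begin

text \<open>
  A weight \<open>c\<^sub>0 \<Lambda>\<^sub>0 + ... + c\<^sub>n \<Lambda>\<^sub>n\<close> is identified with the tuple
  \<open>[c\<^sub>0, ..., c\<^sub>n]\<close>, a list of length \<open>n + 1\<close>.  All quantities are integers, so that the
  subtractions below are not truncated.
\<close>

type_synonym weight = "int list"

definition weight_of :: "nat \<Rightarrow> (nat \<Rightarrow> int) \<Rightarrow> weight" where
  "weight_of n f = map f [0..<n + 1]"

definition dominant_weights :: "nat \<Rightarrow> int \<Rightarrow> weight set" where
  "dominant_weights n ell = {c. length c = n + 1 \<and> (\<forall>x \<in> set c. 0 \<le> x) \<and> sum_list c = ell}"

text \<open>
  An array \<open>A\<close> has entries \<open>A p q\<close> with \<open>p\<close> the column index and \<open>q\<close> the row index.  Arrays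
  are total functions, made to vanish outside the index range so that equality of functions is
  equality of arrays.
\<close>

type_synonym arr = "nat \<Rightarrow> nat \<Rightarrow> int"

definition is_path :: "nat \<Rightarrow> nat \<Rightarrow> (nat \<Rightarrow> nat \<times> nat) \<Rightarrow> bool" where
  "is_path n i \<beta> \<longleftrightarrow> \<beta> 1 = (1, i) \<and> \<beta> n = (i, n) \<and>
     (\<forall>s p q. 1 \<le> s \<and> s < n \<and> \<beta> s = (p, q) \<longrightarrow> \<beta> (s + 1) \<in> {(p, q + 1), (p + 1, q)})"

definition crystal :: "nat \<Rightarrow> nat \<Rightarrow> int \<Rightarrow> arr set" where
  "crystal n i ell =
     {A. (\<forall>p q. 0 \<le> A p q) \<and>
         (\<forall>p q. \<not> (1 \<le> p \<and> p \<le> i \<and> i \<le> q \<and> q \<le> n) \<longrightarrow> A p q = 0) \<and>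
         (\<forall>\<beta>. is_path n i \<beta> \<longrightarrow> (\<Sum>s = 1..n. A (fst (\<beta> s)) (snd (\<beta> s))) \<le> ell)}"

definition F :: "nat \<Rightarrow> arr \<Rightarrow> nat \<Rightarrow> nat \<Rightarrow> int" where
  "F i A l p = (\<Sum>j = 1..p. A j (l - 1)) + (\<Sum>j = p..i. A j l)"

definition G :: "nat \<Rightarrow> nat \<Rightarrow> arr \<Rightarrow> nat \<Rightarrow> nat \<Rightarrow> int" where
  "G n i A l p = (\<Sum>j = i..p. A l j) + (\<Sum>j = p..n. A (l + 1) j)"

definition p_plus :: "nat \<Rightarrow> arr \<Rightarrow> nat \<Rightarrow> nat" where
  "p_plus i A l = Min {p. is_arg_max (F i A l) (\<lambda>p. p \<in> {1..i}) p}"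

definition q_plus :: "nat \<Rightarrow> arr \<Rightarrow> nat \<Rightarrow> nat" where
  "q_plus i A l = Max {p. is_arg_max (F i A l) (\<lambda>p. p \<in> {1..i}) p}"

definition p_minus :: "nat \<Rightarrow> nat \<Rightarrow> arr \<Rightarrow> nat \<Rightarrow> nat" where
  "p_minus n i A l = Max {p. is_arg_max (G n i A l) (\<lambda>p. p \<in> {i..n}) p}"

definition q_minus :: "nat \<Rightarrow> nat \<Rightarrow> arr \<Rightarrow> nat \<Rightarrow> nat" where
  "q_minus n i A l = Min {p. is_arg_max (G n i A l) (\<lambda>p. p \<in> {i..n}) p}"

definition phi :: "nat \<Rightarrow> nat \<Rightarrow> int \<Rightarrow> arr \<Rightarrow> nat \<Rightarrow> int" where
  "phi n i ell A l =
     (if l = 0 then A 1 n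
      else if l = i then ell - (\<Sum>j = 1..i - 1. A j i) - (\<Sum>j = i..n. A i j)
      else if l > i then
        (\<Sum>j = 1..p_plus i A l. A j (l - 1)) - (\<Sum>j = 1..p_plus i A l - 1. A j l)
      else
        (\<Sum>j = p_minus n i A l..n. A (l + 1) j) - (\<Sum>j = p_minus n i A l + 1..n. A l j))"

definition eps :: "nat \<Rightarrow> nat \<Rightarrow> int \<Rightarrow> arr \<Rightarrow> nat \<Rightarrow> int" where
  "eps n i ell A l =
     (if l = 0 then ell - (\<Sum>j = i..n. A 1 j) - (\<Sum>j = 2..i. A j n)
      else if l = i then A i i
      else if l > i then
        (\<Sum>j = q_plus i A l..i. A j l) - (\<Sum>j = q_plus i A l + 1..i. A j (l - 1))
      else
        (\<Sum>j = i..q_minus n i A l. A l j) - (\<Sum>j = i..q_minus n i A l - 1. A (l + 1) j))"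

definition phi_weight :: "nat \<Rightarrow> nat \<Rightarrow> int \<Rightarrow> arr \<Rightarrow> weight" where
  "phi_weight n i ell A = weight_of n (phi n i ell A)"

definition eps_weight :: "nat \<Rightarrow> nat \<Rightarrow> int \<Rightarrow> arr \<Rightarrow> weight" where
  "eps_weight n i ell A = weight_of n (eps n i ell A)"

definition min_elem :: "nat \<Rightarrow> nat \<Rightarrow> int \<Rightarrow> weight \<Rightarrow> arr" where
  "min_elem n i ell \<Lambda> = (THE b. b \<in> crystal n i ell \<and> phi_weight n i ell b = \<Lambda>)"

primrec weight_seq :: "nat \<Rightarrow> nat \<Rightarrow> int \<Rightarrow> weight \<Rightarrow> nat \<Rightarrow> weight" where
  "weight_seq n i ell \<Lambda> 0 = \<Lambda>"
| "weight_seq n i ell \<Lambda> (Suc k) = eps_weight n i ell (min_elem n i ell (weight_seq n i ell \<Lambda> k))"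

text \<open>The path \<open>... \<otimes> b\<^sub>1 \<otimes> b\<^sub>0\<close> is the sequence \<open>k \<mapsto> b\<^sub>k\<close>.\<close>

definition ground_state_path :: "nat \<Rightarrow> nat \<Rightarrow> int \<Rightarrow> weight \<Rightarrow> nat \<Rightarrow> arr" where
  "ground_state_path n i ell \<Lambda> k = min_elem n i ell (weight_seq n i ell \<Lambda> k)"

end

theory Submission
  imports Defs
begin

text \<open>
  Everything is governed by the defects \<open>d p q = A (p+1) (q-1) - A p q\<close>, the differences of
  neighbours on an antidiagonal \<open>p + q = const\<close>.  Telescoping turns the signature rules into
  partial sums of defects: for \<open>l > i\<close>,
  \<open>\<phi>\<^sub>l(A) = A 1 (l-1) + R\<^sub>l\<close>, where \<open>R\<^sub>l \<ge> 0\<close> is the largest prefix sum of the defects in row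
  \<open>l\<close>; for \<open>1 \<le> l < i\<close>, \<open>\<phi>\<^sub>l(A) = A (l+1) n + C\<^sub>l\<close>, where \<open>C\<^sub>l \<ge> 0\<close> is the largest suffix sum
  of the defects in column \<open>l\<close>.  The entries \<open>A 1 (l-1)\<close>, \<open>A (l+1) n\<close> and \<open>\<phi>\<^sub>0(A) = A 1 n\<close> add
  up to the weight of the path along column \<open>1\<close> and row \<open>n\<close>, whereas \<open>\<phi>\<^sub>i(A)\<close> is \<open>ell\<close> minus the
  weight of the path along row \<open>i\<close> and column \<open>i\<close>; these two weights differ by the sum \<open>D\<close> of
  all defects.  Hence the level of \<open>\<phi>(A)\<close> is \<open>ell + \<Sum>R + \<Sum>C - D\<close>.

  Since \<open>\<Sum>R \<ge> D\<close> and \<open>\<Sum>C \<ge> D\<close>, level \<open>ell\<close> forces all \<open>R\<^sub>l\<close> and \<open>C\<^sub>l\<close>, and then all defects,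
  to vanish (\<open>defect_zero_of_level\<close>).  So \<open>A\<close> is constant along antidiagonals.  The values of
  \<open>p + q\<close> run through \<open>i+1, ..., i+n\<close>, one representative of each residue modulo \<open>n + 1\<close> other
  than \<open>i\<close>, and the common value on an antidiagonal is the corresponding \<open>\<phi>\<^sub>l(A)\<close>
  (\<open>entry_eq_phi\<close>).  This gives uniqueness of \<open>b\<^sup>\<Lambda>\<close>.  For existence, a path meets every
  antidiagonal once, so in the array with entries \<open>c\<^bsub>(p+q) mod (n+1)\<^esub>\<close> all paths have the same
  weight \<open>ell - c\<^sub>i\<close> (\<open>sum_residues\<close>), and \<open>\<phi>\<close> and \<open>\<epsilon>\<close> can be read off from the vanishing of
  the defects: \<open>\<epsilon>\<close> is \<open>\<phi>\<close> rotated by \<open>i\<close> positions.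
\<close>

section \<open>Telescoping and the maximum conditions\<close>

definition defect :: "arr \<Rightarrow> nat \<Rightarrow> nat \<Rightarrow> int" where
  "defect A p q = A (p + 1) (q - 1) - A p q"

text \<open>
  With \<open>a \<ge> 1\<close> the interval \<open>{a..p - 1}\<close> is empty for \<open>p = a\<close>, in spite of the truncated
  subtraction.
\<close>

lemma prefix_telescope:
  fixes x y :: "nat \<Rightarrow> int"
  assumes "1 \<le> a" "a \<le> p"
  shows "(\<Sum>j = a..p. x j) - (\<Sum>j = a..p - 1. y j) = x a + (\<Sum>j = a..<p. x (j + 1) - y j)"
  using assms(2)
proof (induction p rule: dec_induct)
  case base
  then show ?case using assms(1) by simp
next
  case (step m)
  have "(\<Sum>j = a..m. y j) = (\<Sum>j = a..m - 1. y j) + y m"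
    using step(1) assms(1) by (cases m) auto
  then show ?case using step by simp
qed

lemma suffix_telescope:
  fixes x y :: "nat \<Rightarrow> int"
  assumes "p \<le> n"
  shows "(\<Sum>j = p..n. x j) - (\<Sum>j = p + 1..n. y j) = x n + (\<Sum>j = p + 1..n. x (j - 1) - y j)"
  using assms by (induction n rule: dec_induct) simp_all

lemma finite_arg_max:
  fixes f :: "nat \<Rightarrow> int"
  assumes "a \<le> b"
  shows "finite {p. is_arg_max f (\<lambda>p. p \<in> {a..b}) p}"
    and "{p. is_arg_max f (\<lambda>p. p \<in> {a..b}) p} \<noteq> {}"
proof -
  show "finite {p. is_arg_max f (\<lambda>p. p \<in> {a..b}) p}"
    by (rule finite_subset[of _ "{a..b}"]) (auto simp: is_arg_max_def)
  have "Max (f ` {a..b}) \<in> f ` {a..b}" using assms by (intro Max_in) auto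
  then obtain p where p: "p \<in> {a..b}" "Max (f ` {a..b}) = f p" by blast
  have "f q \<le> f p" if "q \<in> {a..b}" for q
    using that p(2) by (metis Max_ge finite_atLeastAtMost finite_imageI imageI)
  then show "{p. is_arg_max f (\<lambda>p. p \<in> {a..b}) p} \<noteq> {}"
    using p(1) by (auto simp: is_arg_max_linorder)
qed

lemma is_arg_max_Min_Max:
  fixes f :: "nat \<Rightarrow> int"
  assumes "a \<le> b"
  shows "is_arg_max f (\<lambda>p. p \<in> {a..b}) (Min {p. is_arg_max f (\<lambda>p. p \<in> {a..b}) p})"
    and "is_arg_max f (\<lambda>p. p \<in> {a..b}) (Max {p. is_arg_max f (\<lambda>p. p \<in> {a..b}) p})"
  using Min_in[OF finite_arg_max[OF assms, of f]] Max_in[OF finite_arg_max[OF assms, of f]]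
  by simp_all

section \<open>Partial sums of defects\<close>

lemma F_eq_prefix_defects:
  assumes "p \<in> {1..i}"
  shows "F i A l p = A 1 (l - 1) + (\<Sum>j = 1..<p. defect A j l) + (\<Sum>j = 1..i. A j l)"
proof -
  have "(\<Sum>j = 1..i. A j l) = (\<Sum>j = 1..p - 1. A j l) + (\<Sum>j = p..i. A j l)"
    using assms sum.ub_add_nat[of 1 "p - 1" "\<lambda>j. A j l" "i - (p - 1)"] by simp
  then show ?thesis
    using prefix_telescope[of 1 p "\<lambda>j. A j (l - 1)" "\<lambda>j. A j l"] assms
    by (simp add: F_def defect_def)
qed

lemma G_eq_suffix_defects:
  assumes "p \<in> {i..n}"
  shows "G n i A l p = A (l + 1) n + (\<Sum>j = p + 1..n. defect A l j) + (\<Sum>j = i..n. A l j)"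
proof -
  have "(\<Sum>j = i..n. A l j) = (\<Sum>j = i..p. A l j) + (\<Sum>j = p + 1..n. A l j)"
    using assms sum.ub_add_nat[of i p "\<lambda>j. A l j" "n - p"] by simp
  then show ?thesis
    using suffix_telescope[of p n "\<lambda>j. A (l + 1) j" "\<lambda>j. A l j"] assms
    by (simp add: G_def defect_def)
qed

lemma phi_above:
  assumes "1 \<le> i" "i < l"
  shows "\<exists>p \<in> {1..i}. phi n i ell A l = A 1 (l - 1) + (\<Sum>j = 1..<p. defect A j l)"
    and "m \<in> {1..i} \<Longrightarrow> A 1 (l - 1) + (\<Sum>j = 1..<m. defect A j l) \<le> phi n i ell A l"
proof -
  define p where "p = p_plus i A l"
  have am: "is_arg_max (F i A l) (\<lambda>p. p \<in> {1..i}) p"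
    unfolding p_def p_plus_def using assms by (intro is_arg_max_Min_Max)
  then have p: "p \<in> {1..i}" by (simp add: is_arg_max_def)
  have phi: "phi n i ell A l = A 1 (l - 1) + (\<Sum>j = 1..<p. defect A j l)"
    using assms p prefix_telescope[of 1 p "\<lambda>j. A j (l - 1)" "\<lambda>j. A j l"]
    by (simp add: phi_def p_def[symmetric] defect_def)
  then show "\<exists>p \<in> {1..i}. phi n i ell A l = A 1 (l - 1) + (\<Sum>j = 1..<p. defect A j l)"
    using p by blast
  assume m: "m \<in> {1..i}"
  then have "F i A l m \<le> F i A l p" using am by (simp add: is_arg_max_linorder)
  then show "A 1 (l - 1) + (\<Sum>j = 1..<m. defect A j l) \<le> phi n i ell A l"
    using phi F_eq_prefix_defects[OF m] F_eq_prefix_defects[OF p] by simp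
qed

lemma phi_below:
  assumes "1 \<le> l" "l < i" "i \<le> n"
  shows "\<exists>p \<in> {i..n}. phi n i ell A l = A (l + 1) n + (\<Sum>j = p + 1..n. defect A l j)"
    and "m \<in> {i..n} \<Longrightarrow> A (l + 1) n + (\<Sum>j = m + 1..n. defect A l j) \<le> phi n i ell A l"
proof -
  define p where "p = p_minus n i A l"
  have am: "is_arg_max (G n i A l) (\<lambda>p. p \<in> {i..n}) p"
    unfolding p_def p_minus_def using assms by (intro is_arg_max_Min_Max)
  then have p: "p \<in> {i..n}" by (simp add: is_arg_max_def)
  have phi: "phi n i ell A l = A (l + 1) n + (\<Sum>j = p + 1..n. defect A l j)"
    using assms p suffix_telescope[of p n "\<lambda>j. A (l + 1) j" "\<lambda>j. A l j"]
    by (simp add: phi_def p_def[symmetric] defect_def)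
  then show "\<exists>p \<in> {i..n}. phi n i ell A l = A (l + 1) n + (\<Sum>j = p + 1..n. defect A l j)"
    using p by blast
  assume m: "m \<in> {i..n}"
  then have "G n i A l m \<le> G n i A l p" using am by (simp add: is_arg_max_linorder)
  then show "A (l + 1) n + (\<Sum>j = m + 1..n. defect A l j) \<le> phi n i ell A l"
    using phi G_eq_suffix_defects[OF m] G_eq_suffix_defects[OF p] by simp
qed

section \<open>Arrays of minimal level\<close>

text \<open>
  The two hooks are the paths through the corners \<open>(i, i)\<close> and \<open>(1, n)\<close>.  All entries off the
  hooks cancel in the sum of the defects, as each of them occurs there once with either sign.
\<close>

lemma hook_difference:
  assumes "1 \<le> i" "i \<le> n"
  shows "(\<Sum>l = i + 1..n. \<Sum>j = 1..<i. defect A j l)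
     = ((\<Sum>j = 1..i - 1. A j i) + (\<Sum>j = i..n. A i j))
       - (A 1 n + (\<Sum>l = i + 1..n. A 1 (l - 1)) + (\<Sum>l = 1..<i. A (l + 1) n))"
proof -
  define R where "R l = (\<Sum>j = 1..i. A j l)" for l
  have first: "R l = A 1 l + (\<Sum>j = 1..<i. A (j + 1) l)" for l
    unfolding R_def using assms(1) by (induction i rule: dec_induct) simp_all
  have last: "R l = (\<Sum>j = 1..<i. A j l) + A i l" for l
    unfolding R_def using assms(1) by (cases i) (simp_all add: atLeastLessThanSuc_atLeastAtMost)
  have row: "(\<Sum>j = 1..<i. defect A j l) = R (l - 1) - R l - A 1 (l - 1) + A i l" for l
    using first[of "l - 1"] last[of l] by (simp add: defect_def sum_subtractf)
  have telescope: "(\<Sum>l = i + 1..n. R (l - 1) - R l) = R i - R n"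
    using assms(2) by (induction n rule: dec_induct) simp_all
  have corner: "(\<Sum>j = i..n. A i j) = A i i + (\<Sum>l = i + 1..n. A i l)"
    using assms(2) by (simp add: sum.atLeast_Suc_atMost)
  have bottom: "(\<Sum>j = 1..i - 1. A j i) = R i - A i i"
    using last[of i] assms(1) by (cases i) (simp_all add: atLeastLessThanSuc_atLeastAtMost)
  have "(\<Sum>l = i + 1..n. \<Sum>j = 1..<i. defect A j l)
      = (\<Sum>l = i + 1..n. R (l - 1) - R l) - (\<Sum>l = i + 1..n. A 1 (l - 1))
        + (\<Sum>l = i + 1..n. A i l)"
    unfolding row by (simp add: sum.distrib sum_subtractf)
  then show ?thesis using telescope corner bottom first[of n] by simp
qed

lemma sum_split_at:
  fixes f :: "nat \<Rightarrow> int"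
  assumes "1 \<le> i" "i \<le> n"
  shows "(\<Sum>l<n + 1. f l) = f 0 + (\<Sum>l = 1..<i. f l) + f i + (\<Sum>l = i + 1..n. f l)"
proof -
  have "{..<n + 1} = insert 0 ({1..<i} \<union> insert i {i + 1..n})" using assms by auto
  moreover have "sum f ({1..<i} \<union> {i + 1..n}) = sum f {1..<i} + sum f {i + 1..n}"
    by (rule sum.union_disjoint) auto
  ultimately show ?thesis using assms by simp
qed

text \<open>
  The excesses \<open>R l\<close> and \<open>C l\<close> are upper bounds for the sum of the defects in row \<open>l\<close> and column \<open>l\<close>.  As
  \<open>\<Sum>R + \<Sum>C\<close> equals the total defect while \<open>\<Sum>R\<close> and \<open>\<Sum>C\<close> are each at least as large, both are
  \<open>\<le> 0\<close>, and all excesses and the total defect vanish.  Then the prefix sums of the rows are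
  \<open>\<le> 0\<close>, and the column sums vanish, being \<open>\<le> 0\<close> with total \<open>0\<close>; peeling off columns from the left, a column of non-positive defects with sum \<open>0\<close> is zero.
\<close>

lemma defect_zero_of_level:
  assumes i: "1 \<le> i" "i \<le> n"
    and level: "(\<Sum>l<n + 1. phi n i ell A l) = ell"
    and pq: "p \<in> {1..<i}" "q \<in> {i + 1..n}"
  shows "defect A p q = 0"
proof -
  let ?d = "defect A"
  define R where "R l = phi n i ell A l - A 1 (l - 1)" for l
  define C where "C l = phi n i ell A l - A (l + 1) n" for l
  have R: "(\<Sum>j = 1..<m. ?d j l) \<le> R l" if "l \<in> {i + 1..n}" "m \<in> {1..i}" for l m
    using phi_above(2)[of i l m A n ell] that i by (simp add: R_def)
  have C: "(\<Sum>j = m + 1..n. ?d l j) \<le> C l" if "l \<in> {1..<i}" "m \<in> {i..n}" for l m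
    using phi_below(2)[of l i n m A ell] that i by (simp add: C_def)
  have R0: "0 \<le> R l" if "l \<in> {i + 1..n}" for l using R[OF that, of 1] i by simp
  have C0: "0 \<le> C l" if "l \<in> {1..<i}" for l using C[OF that, of n] i by simp
  define D where "D = (\<Sum>l = i + 1..n. \<Sum>j = 1..<i. ?d j l)"
  have swap: "D = (\<Sum>j = 1..<i. \<Sum>l = i + 1..n. ?d j l)"
    unfolding D_def by (rule sum.swap)
  have total: "(\<Sum>l = i + 1..n. R l) + (\<Sum>l = 1..<i. C l) = D"
  proof -
    have "phi n i ell A 0 = A 1 n" by (simp add: phi_def)
    moreover have "phi n i ell A i = ell - ((\<Sum>j = 1..i - 1. A j i) + (\<Sum>j = i..n. A i j))"
      using i by (simp add: phi_def)
    ultimately show ?thesis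
      using level sum_split_at[OF i, of "phi n i ell A"] hook_difference[OF i, of A]
      unfolding D_def R_def C_def by (simp add: sum_subtractf)
  qed
  have "D \<le> (\<Sum>l = i + 1..n. R l)"
    unfolding D_def by (rule sum_mono) (use R i in auto)
  moreover have col_le: "(\<Sum>l = i + 1..n. ?d j l) \<le> C j" if "j \<in> {1..<i}" for j
    using C[OF that, of i] i by simp
  then have "D \<le> (\<Sum>l = 1..<i. C l)"
    unfolding swap by (rule sum_mono)
  moreover have "0 \<le> (\<Sum>l = i + 1..n. R l)" "0 \<le> (\<Sum>l = 1..<i. C l)"
    using R0 C0 by (auto intro: sum_nonneg)
  ultimately have sums: "(\<Sum>l = i + 1..n. R l) = 0" "(\<Sum>l = 1..<i. C l) = 0" "D = 0"
    using total by auto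
  have Rz: "R l = 0" if "l \<in> {i + 1..n}" for l
    using sums(1) R0 that sum_nonneg_eq_0_iff[of "{i + 1..n}" R] by auto
  have Cz: "C l = 0" if "l \<in> {1..<i}" for l
    using sums(2) C0 that sum_nonneg_eq_0_iff[of "{1..<i}" C] by auto
  have col: "(\<Sum>l = i + 1..n. ?d j l) = 0" if j: "j \<in> {1..<i}" for j
  proof -
    have "\<forall>j \<in> {1..<i}. 0 \<le> - (\<Sum>l = i + 1..n. ?d j l)" using col_le Cz by fastforce
    moreover have "(\<Sum>j = 1..<i. - (\<Sum>l = i + 1..n. ?d j l)) = 0"
      using sums(3) swap by (simp add: sum_negf)
    ultimately have "\<forall>j \<in> {1..<i}. - (\<Sum>l = i + 1..n. ?d j l) = 0"
      using sum_nonneg_eq_0_iff[of "{1..<i}" "\<lambda>j. - (\<Sum>l = i + 1..n. ?d j l)"] by auto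
    then show ?thesis using j by simp
  qed
  have "\<forall>l \<in> {i + 1..n}. ?d p l = 0"
    using pq(1)
  proof (induction p rule: less_induct)
    case (less p)
    have nonneg: "0 \<le> - ?d p l" if l: "l \<in> {i + 1..n}" for l
    proof -
      have "(\<Sum>j = 1..<p. ?d j l) = 0" using less l by (intro sum.neutral) auto
      moreover have "(\<Sum>j = 1..<Suc p. ?d j l) \<le> 0" using R[OF l, of "Suc p"] Rz[OF l] less(2) by simp
      ultimately show ?thesis using less(2) by simp
    qed
    have "(\<Sum>l = i + 1..n. - ?d p l) = 0" using col[OF less(2)] by (simp add: sum_negf)
    then have "\<forall>l \<in> {i + 1..n}. - ?d p l = 0"
      using nonneg sum_nonneg_eq_0_iff[of "{i + 1..n}" "\<lambda>l. - ?d p l"] by auto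
    then show ?case by simp
  qed
  then show ?thesis using pq(2) by blast
qed

section \<open>Arrays that are constant along antidiagonals\<close>

lemma antidiagonal_const:
  assumes flat: "\<And>p q. p \<in> {1..<i} \<Longrightarrow> q \<in> {i + 1..n} \<Longrightarrow> defect A p q = 0"
    and "1 \<le> p" "p + k \<le> i" "i \<le> q" "q + k \<le> n"
  shows "A (p + k) q = A p (q + k)"
  using assms(3-5)
proof (induction k arbitrary: q)
  case (Suc k)
  have "A (p + k + 1) q = A (p + k) (q + 1)"
    using flat[of "p + k" "q + 1"] Suc.prems assms(2) by (simp add: defect_def)
  also have "\<dots> = A p (q + 1 + k)"
    using Suc.IH[of "q + 1"] Suc.prems by simp
  finally show ?case by simp
qed simp

text \<open>
  Sliding along its antidiagonal, an entry reaches column \<open>1\<close> if \<open>p + q \<le> n + 1\<close> and row \<open>n\<close>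
  otherwise; the entries there are the values of \<open>phi\<close> because all partial sums of defects vanish.
\<close>

lemma entry_eq_phi:
  assumes i: "1 \<le> i" "i \<le> n"
    and flat: "\<And>p q. p \<in> {1..<i} \<Longrightarrow> q \<in> {i + 1..n} \<Longrightarrow> defect A p q = 0"
    and pq: "p \<in> {1..i}" "q \<in> {i..n}"
  shows "A p q = phi n i ell A ((p + q) mod (n + 1))"
proof (cases "p + q \<le> n + 1")
  case True
  have A: "A p q = A 1 (p + q - 1)"
  proof -
    have "q + (p - 1) = p + q - 1" "1 + (p - 1) = p" using pq by auto
    then show ?thesis using antidiagonal_const[of i n A 1 "p - 1" q, OF flat] pq True by auto
  qed
  show ?thesis
  proof (cases "p + q = n + 1")
    case True
    then show ?thesis using A by (simp add: phi_def)
  next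
    case False
    with \<open>p + q \<le> n + 1\<close> have l: "p + q \<le> n" by simp
    have "i < p + q" using pq by auto
    then obtain m where m: "m \<in> {1..i}"
      "phi n i ell A (p + q) = A 1 (p + q - 1) + (\<Sum>j = 1..<m. defect A j (p + q))"
      using phi_above(1)[of i "p + q" n ell A] i by blast
    have "(\<Sum>j = 1..<m. defect A j (p + q)) = 0"
      using m(1) l \<open>i < p + q\<close> by (intro sum.neutral ballI flat) auto
    then show ?thesis using A m(2) l by simp
  qed
next
  case False
  define l where "l = p + q - (n + 1)"
  have l: "1 \<le> l" "l < i" "p + q = l + (n + 1)" using False pq by (auto simp: l_def)
  have A: "A p q = A (l + 1) n"
  proof -
    have "l + 1 + (n - q) = p" "q + (n - q) = n" using pq l by auto
    then show ?thesis
      using antidiagonal_const[of i n A "l + 1" "n - q" q, OF flat] pq by simp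
  qed
  obtain m where m: "m \<in> {i..n}"
    "phi n i ell A l = A (l + 1) n + (\<Sum>j = m + 1..n. defect A l j)"
    using phi_below(1)[of l i n ell A] l i by blast
  have "(\<Sum>j = m + 1..n. defect A l j) = 0"
    using m(1) l by (intro sum.neutral ballI flat) auto
  moreover have "(p + q) mod (n + 1) = l" using l i by (simp only: mod_add_self2) simp
  ultimately show ?thesis using A m(2) by simp
qed

lemma eps_above:
  assumes i: "1 \<le> i" "i < l" "l \<le> n"
    and flat: "\<And>p q. p \<in> {1..<i} \<Longrightarrow> q \<in> {i + 1..n} \<Longrightarrow> defect A p q = 0"
  shows "eps n i ell A l = A i l"
proof -
  define p where "p = q_plus i A l"
  have "is_arg_max (F i A l) (\<lambda>p. p \<in> {1..i}) p"
    unfolding p_def q_plus_def using i by (intro is_arg_max_Min_Max)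
  then have p: "1 \<le> p" "p \<le> i" by (simp_all add: is_arg_max_def)
  have "(\<Sum>j = p + 1..i. A (j - 1) l - A j (l - 1)) = 0"
  proof (intro sum.neutral ballI)
    fix j assume "j \<in> {p + 1..i}"
    then obtain m where "j = m + 1" "m \<in> {1..<i}"
      using p by (cases j) auto
    then show "A (j - 1) l - A j (l - 1) = 0"
      using flat[of m l] i by (simp add: defect_def)
  qed
  then show ?thesis
    using i p suffix_telescope[of p i "\<lambda>j. A j l" "\<lambda>j. A j (l - 1)"]
    by (simp add: eps_def p_def[symmetric])
qed

lemma eps_below:
  assumes i: "1 \<le> l" "l < i" "i \<le> n"
    and flat: "\<And>p q. p \<in> {1..<i} \<Longrightarrow> q \<in> {i + 1..n} \<Longrightarrow> defect A p q = 0"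
  shows "eps n i ell A l = A l i"
proof -
  define p where "p = q_minus n i A l"
  have "is_arg_max (G n i A l) (\<lambda>p. p \<in> {i..n}) p"
    unfolding p_def q_minus_def using i by (intro is_arg_max_Min_Max)
  then have p: "i \<le> p" "p \<le> n" by (simp_all add: is_arg_max_def)
  have "(\<Sum>j = i..<p. A l (j + 1) - A (l + 1) j) = 0"
  proof (intro sum.neutral ballI)
    fix j assume "j \<in> {i..<p}"
    then show "A l (j + 1) - A (l + 1) j = 0"
      using flat[of l "j + 1"] p i by (simp add: defect_def)
  qed
  then show ?thesis
    using i p prefix_telescope[of i p "\<lambda>j. A l j" "\<lambda>j. A (l + 1) j"]
    by (simp add: eps_def p_def[symmetric])
qed

section \<open>The minimal element of a given weight\<close>

definition antidiagonal_array :: "nat \<Rightarrow> nat \<Rightarrow> weight \<Rightarrow> arr" where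
  "antidiagonal_array n i c p q =
     (if 1 \<le> p \<and> p \<le> i \<and> i \<le> q \<and> q \<le> n then c ! ((p + q) mod (n + 1)) else 0)"

lemma antidiagonal_array_flat:
  assumes "p \<in> {1..<i}" "q \<in> {i + 1..n}"
  shows "defect (antidiagonal_array n i c) p q = 0"
  using assms by (auto simp: defect_def antidiagonal_array_def)

text \<open>The numbers \<open>i + 1, ..., i + n\<close> hit every residue modulo \<open>n + 1\<close> other than \<open>i\<close> once.\<close>

lemma sum_residues:
  fixes c :: weight
  assumes c: "c \<in> dominant_weights n ell" and "i \<le> n"
  shows "(\<Sum>m = i + 1..i + n. c ! (m mod (n + 1))) = ell - c ! i"
proof -
  have "(\<Sum>m = i..i + n. c ! (m mod (n + 1)))
      = (\<Sum>m = i..n. c ! (m mod (n + 1))) + (\<Sum>m = 0 + (n + 1)..<i + (n + 1). c ! (m mod (n + 1)))"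
  proof -
    have "{i..i + n} = {i..n} \<union> {0 + (n + 1)..<i + (n + 1)}" using assms(2) by auto
    then show ?thesis by (simp only:) (rule sum.union_disjoint; auto)
  qed
  also have "(\<Sum>m = i..n. c ! (m mod (n + 1))) = (\<Sum>m = i..<n + 1. c ! m)"
    by (rule sum.cong) auto
  also have "(\<Sum>m = 0 + (n + 1)..<i + (n + 1). c ! (m mod (n + 1))) = (\<Sum>m = 0..<i. c ! m)"
    unfolding sum.shift_bounds_nat_ivl using assms(2) by (intro sum.cong) (auto simp del: add_Suc_right)
  also have "(\<Sum>m = i..<n + 1. c ! m) + (\<Sum>m = 0..<i. c ! m) = (\<Sum>m = 0..<n + 1. c ! m)"
    using assms(2) sum.atLeastLessThan_concat[of 0 i "n + 1" "(!) c"] by simp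
  also have "\<dots> = ell"
    using c by (auto simp: dominant_weights_def sum_list_sum_nth simp del: sum.op_ivl_Suc)
  finally have "(\<Sum>m = i..i + n. c ! (m mod (n + 1))) = ell" .
  moreover have "(\<Sum>m = i..i + n. c ! (m mod (n + 1)))
      = c ! i + (\<Sum>m = i + 1..i + n. c ! (m mod (n + 1)))"
    using assms(2) by (simp add: sum.atLeast_Suc_atMost)
  ultimately show ?thesis by simp
qed

lemma path_antidiagonal:
  assumes "is_path n i \<beta>" "1 \<le> s" "s \<le> n"
  shows "fst (\<beta> s) + snd (\<beta> s) = i + s"
  using assms(2,3)
proof (induction s rule: dec_induct)
  case base
  then show ?case using assms(1) by (simp add: is_path_def)
next
  case (step s)
  obtain p q where pq: "\<beta> s = (p, q)" by fastforce
  then have "\<beta> (s + 1) \<in> {(p, q + 1), (p + 1, q)}"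
    using assms(1) step by (auto simp: is_path_def)
  then show ?case using step pq by auto
qed

lemma antidiagonal_array_in_crystal:
  assumes c: "c \<in> dominant_weights n ell" and "i \<le> n"
  shows "antidiagonal_array n i c \<in> crystal n i ell"
proof -
  have pos: "0 \<le> c ! (m mod (n + 1))" for m
  proof -
    have "m mod (n + 1) < length c" using c by (simp add: dominant_weights_def)
    then show ?thesis using c nth_mem by (fastforce simp: dominant_weights_def)
  qed
  have "(\<Sum>s = 1..n. antidiagonal_array n i c (fst (\<beta> s)) (snd (\<beta> s))) \<le> ell"
    if path: "is_path n i \<beta>" for \<beta>
  proof -
    \<comment> \<open>The inequality covers positions outside the index range, where the array has entry \<open>0\<close>.\<close>
    have "(\<Sum>s = 1..n. antidiagonal_array n i c (fst (\<beta> s)) (snd (\<beta> s)))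
        \<le> (\<Sum>s = 1..n. c ! ((i + s) mod (n + 1)))"
    proof (rule sum_mono)
      fix s assume "s \<in> {1..n}"
      then have "fst (\<beta> s) + snd (\<beta> s) = i + s" using path_antidiagonal[OF path] by simp
      then show "antidiagonal_array n i c (fst (\<beta> s)) (snd (\<beta> s)) \<le> c ! ((i + s) mod (n + 1))"
        using pos[of "i + s"] by (simp add: antidiagonal_array_def)
    qed
    also have "\<dots> = (\<Sum>m = i + 1..i + n. c ! (m mod (n + 1)))"
      using sum.shift_bounds_cl_nat_ivl[of "\<lambda>m. c ! (m mod (n + 1))" 1 i n]
      by (simp add: add.commute)
    also have "\<dots> \<le> ell" using sum_residues[OF assms] pos[of i] assms(2) by simp
    finally show ?thesis .
  qed
  then show ?thesis
    using pos by (simp add: crystal_def antidiagonal_array_def)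
qed

lemma phi_antidiagonal_array:
  assumes i: "1 \<le> i" "i \<le> n" and c: "c \<in> dominant_weights n ell" and l: "l \<le> n"
  shows "phi n i ell (antidiagonal_array n i c) l = c ! l"
proof -
  let ?A = "antidiagonal_array n i c"
  have entry: "c ! ((p + q) mod (n + 1)) = phi n i ell ?A ((p + q) mod (n + 1))"
    if "p \<in> {1..i}" "q \<in> {i..n}" for p q
    using entry_eq_phi[of i n ?A p q ell, OF i antidiagonal_array_flat that] that
    by (simp add: antidiagonal_array_def)
  consider "l = 0" | "l = i" | "i < l" | "1 \<le> l" "l < i" by linarith
  then show ?thesis
  proof cases
    case 1
    then show ?thesis using entry[of 1 n] i by simp
  next
    case 2
    have "(\<Sum>j = 1..i - 1. ?A j i) = (\<Sum>j = 1..i - 1. c ! ((j + i) mod (n + 1)))"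
      using i by (intro sum.cong) (auto simp: antidiagonal_array_def)
    also have "\<dots> = (\<Sum>m = i + 1..i + (i - 1). c ! (m mod (n + 1)))"
      using sum.shift_bounds_cl_nat_ivl[of "\<lambda>m. c ! (m mod (n + 1))" 1 i "i - 1"]
      by (simp add: add.commute)
    finally have row: "(\<Sum>j = 1..i - 1. ?A j i) = (\<Sum>m = i + 1..i + (i - 1). c ! (m mod (n + 1)))" .
    have "(\<Sum>j = i..n. ?A i j) = (\<Sum>j = i..n. c ! ((j + i) mod (n + 1)))"
      using i by (intro sum.cong) (auto simp: antidiagonal_array_def add.commute)
    also have "\<dots> = (\<Sum>m = i + i..i + n. c ! (m mod (n + 1)))"
      using sum.shift_bounds_cl_nat_ivl[of "\<lambda>m. c ! (m mod (n + 1))" i i n]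
      by (simp add: add.commute)
    finally have column: "(\<Sum>j = i..n. ?A i j) = (\<Sum>m = i + i..i + n. c ! (m mod (n + 1)))" .
    have "{i + 1..i + n} = {i + 1..i + (i - 1)} \<union> {i + i..i + n}" using i by auto
    then have "(\<Sum>m = i + 1..i + n. c ! (m mod (n + 1)))
        = (\<Sum>j = 1..i - 1. ?A j i) + (\<Sum>j = i..n. ?A i j)"
      unfolding row column using i by (simp only:) (rule sum.union_disjoint; auto)
    then show ?thesis using 2 i sum_residues[OF c i(2)] by (simp add: phi_def)
  next
    case 3
    then have "l - 1 \<in> {i..n}" "1 + (l - 1) = l" using l by auto
    then show ?thesis using entry[of 1 "l - 1"] i l by simp
  next
    case 4
    have "(l + 1 + n) mod (n + 1) = l" using l by (simp add: mod_add_self2[of l "n + 1", simplified])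
    then show ?thesis using entry[of "l + 1" n] i 4 by simp
  qed
qed

lemma eps_antidiagonal_array:
  assumes i: "1 \<le> i" "i \<le> n" and c: "c \<in> dominant_weights n ell" and l: "l \<le> n"
  shows "eps n i ell (antidiagonal_array n i c) l = c ! ((i + l) mod (n + 1))"
proof -
  let ?A = "antidiagonal_array n i c"
  consider "l = 0" | "l = i" | "i < l" | "1 \<le> l" "l < i" by linarith
  then show ?thesis
  proof cases
    case 1
    have "(\<Sum>j = i..n. ?A 1 j) = (\<Sum>j = i..n. c ! ((j + 1) mod (n + 1)))"
      using i by (intro sum.cong) (auto simp: antidiagonal_array_def)
    also have "\<dots> = (\<Sum>m = i + 1..n + 1. c ! (m mod (n + 1)))"
      using sum.shift_bounds_cl_nat_ivl[of "\<lambda>m. c ! (m mod (n + 1))" i 1 n] by simp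
    finally have column: "(\<Sum>j = i..n. ?A 1 j) = (\<Sum>m = i + 1..n + 1. c ! (m mod (n + 1)))" .
    have "(\<Sum>j = 2..i. ?A j n) = (\<Sum>j = 2..i. c ! ((j + n) mod (n + 1)))"
      using i by (intro sum.cong) (auto simp: antidiagonal_array_def)
    also have "\<dots> = (\<Sum>m = 2 + n..i + n. c ! (m mod (n + 1)))"
      using sum.shift_bounds_cl_nat_ivl[of "\<lambda>m. c ! (m mod (n + 1))" 2 n i] by simp
    finally have row: "(\<Sum>j = 2..i. ?A j n) = (\<Sum>m = 2 + n..i + n. c ! (m mod (n + 1)))" .
    have "{i + 1..i + n} = {i + 1..n + 1} \<union> {2 + n..i + n}" using i by auto
    then have "(\<Sum>m = i + 1..i + n. c ! (m mod (n + 1)))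
        = (\<Sum>j = i..n. ?A 1 j) + (\<Sum>j = 2..i. ?A j n)"
      unfolding row column by (simp only:) (rule sum.union_disjoint; auto)
    then show ?thesis using 1 i sum_residues[OF c i(2)] by (simp add: eps_def)
  next
    case 2
    then show ?thesis using i by (simp add: eps_def antidiagonal_array_def)
  next
    case 3
    then have "eps n i ell ?A l = ?A i l"
      using i l by (intro eps_above[of i l n]) (auto intro: antidiagonal_array_flat)
    then show ?thesis using 3 i l by (simp add: antidiagonal_array_def)
  next
    case 4
    then have "eps n i ell ?A l = ?A l i"
      using i by (intro eps_below[of l i n]) (auto intro: antidiagonal_array_flat)
    then show ?thesis using 4 i by (simp add: antidiagonal_array_def add.commute)
  qed
qed

lemma phi_weight_antidiagonal_array:
  assumes "1 \<le> i" "i \<le> n" and "c \<in> dominant_weights n ell"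
  shows "phi_weight n i ell (antidiagonal_array n i c) = c"
proof (rule nth_equalityI)
  show len: "length (phi_weight n i ell (antidiagonal_array n i c)) = length c"
    using assms(3) by (simp add: phi_weight_def weight_of_def dominant_weights_def)
  fix l assume "l < length (phi_weight n i ell (antidiagonal_array n i c))"
  then have "l \<le> n" by (simp add: phi_weight_def weight_of_def)
  then show "phi_weight n i ell (antidiagonal_array n i c) ! l = c ! l"
    using phi_antidiagonal_array[OF assms]
    by (simp add: phi_weight_def weight_of_def del: upt_Suc)
qed

lemma eps_weight_antidiagonal_array:
  assumes "1 \<le> i" "i \<le> n" and c: "c \<in> dominant_weights n ell"
  shows "eps_weight n i ell (antidiagonal_array n i c) = rotate i c"
proof (rule nth_equalityI)
  have len: "length c = n + 1" using c by (simp add: dominant_weights_def)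
  then show "length (eps_weight n i ell (antidiagonal_array n i c)) = length (rotate i c)"
    by (simp add: eps_weight_def weight_of_def)
  fix l assume "l < length (eps_weight n i ell (antidiagonal_array n i c))"
  then have "l \<le> n" by (simp add: eps_weight_def weight_of_def)
  then show "eps_weight n i ell (antidiagonal_array n i c) ! l = rotate i c ! l"
    using eps_antidiagonal_array[OF assms] len
    by (simp add: eps_weight_def weight_of_def nth_rotate del: upt_Suc)
qed

lemma minimal_element_unique:
  assumes i: "1 \<le> i" "i \<le> n" and c: "c \<in> dominant_weights n ell"
    and A: "A \<in> crystal n i ell" "phi_weight n i ell A = c"
  shows "A = antidiagonal_array n i c"
proof (intro ext)
  fix p q
  have phi: "phi n i ell A l = c ! l" if "l \<le> n" for l
    using that A(2) by (auto simp: phi_weight_def weight_of_def simp del: upt_Suc)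
  have "(\<Sum>l<n + 1. phi n i ell A l) = (\<Sum>l<n + 1. c ! l)"
    by (intro sum.cong) (auto simp: phi)
  also have "\<dots> = ell"
    using c by (auto simp: dominant_weights_def sum_list_sum_nth atLeast0LessThan
        simp del: sum.lessThan_Suc)
  finally have flat: "defect A p q = 0" if "p \<in> {1..<i}" "q \<in> {i + 1..n}" for p q
    using defect_zero_of_level[OF i _ that] by blast
  show "A p q = antidiagonal_array n i c p q"
  proof (cases "1 \<le> p \<and> p \<le> i \<and> i \<le> q \<and> q \<le> n")
    case True
    then have "A p q = phi n i ell A ((p + q) mod (n + 1))"
      using entry_eq_phi[OF i flat] by simp
    moreover have "(p + q) mod (n + 1) \<le> n" by (simp add: less_Suc_eq_le[symmetric])
    ultimately show ?thesis using True phi by (simp add: antidiagonal_array_def)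
  next
    case False
    then have "A p q = 0" using A(1) by (auto simp: crystal_def)
    then show ?thesis using False by (auto simp: antidiagonal_array_def)
  qed
qed

lemma minimal_element_ex1:
  assumes "1 \<le> i" "i \<le> n" and "c \<in> dominant_weights n ell"
  shows "\<exists>!b. b \<in> crystal n i ell \<and> phi_weight n i ell b = c"
  using antidiagonal_array_in_crystal[OF assms(3,2)] phi_weight_antidiagonal_array[OF assms]
    minimal_element_unique[OF assms] by blast

lemma min_elem_eq:
  assumes "1 \<le> i" "i \<le> n" and "c \<in> dominant_weights n ell"
  shows "min_elem n i ell c = antidiagonal_array n i c"
  unfolding min_elem_def
  using antidiagonal_array_in_crystal[OF assms(3,2)] phi_weight_antidiagonal_array[OF assms]
    minimal_element_unique[OF assms] by blast

section \<open>The ground-state path\<close>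

lemma rotate_dominant:
  assumes "c \<in> dominant_weights n ell"
  shows "rotate k c \<in> dominant_weights n ell"
proof -
  have "sum_list (rotate k c) = sum_list c"
    by (metis add.commute append_take_drop_id rotate_drop_take sum_list_append)
  then show ?thesis using assms by (simp add: dominant_weights_def)
qed

lemma weight_seq_Suc_rotate:
  assumes "1 \<le> i" "i \<le> n" and "weight_seq n i ell \<Lambda> k \<in> dominant_weights n ell"
  shows "weight_seq n i ell \<Lambda> (Suc k) = rotate i (weight_seq n i ell \<Lambda> k)"
  using min_elem_eq[OF assms] eps_weight_antidiagonal_array[OF assms] by simp

lemma weight_seq_dominant:
  assumes "1 \<le> i" "i \<le> n" and "\<Lambda> \<in> dominant_weights n ell"
  shows "weight_seq n i ell \<Lambda> k \<in> dominant_weights n ell"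
proof (induction k)
  case (Suc k)
  then show ?case
    using weight_seq_Suc_rotate[OF assms(1,2) Suc] rotate_dominant by simp
qed (use assms in simp)

theorem mainTheorem5:
  fixes n i :: nat and ell :: int and \<Lambda> :: weight
  assumes "1 \<le> n" and "1 \<le> i" and "i \<le> n" and "1 \<le> ell"
    and "\<Lambda> \<in> dominant_weights n ell"
  shows "weight_seq n i ell \<Lambda> 0 = \<Lambda>
    \<and> weight_seq n i ell \<Lambda> 1 = drop i \<Lambda> @ take i \<Lambda>
    \<and> (\<forall>k. weight_seq n i ell \<Lambda> k \<in> dominant_weights n ell)
    \<and> (\<forall>k. weight_seq n i ell \<Lambda> (k + 1)
           = drop i (weight_seq n i ell \<Lambda> k) @ take i (weight_seq n i ell \<Lambda> k))
    \<and> (\<forall>k. \<exists>!b. b \<in> crystal n i ell \<and> phi_weight n i ell b = weight_seq n i ell \<Lambda> k)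
    \<and> (\<forall>k. ground_state_path n i ell \<Lambda> k = min_elem n i ell (weight_seq n i ell \<Lambda> k))
    \<and> (\<forall>k p q. 1 \<le> p \<and> p \<le> i \<and> i \<le> q \<and> q \<le> n \<longrightarrow>
         min_elem n i ell (weight_seq n i ell \<Lambda> k) p q
           = weight_seq n i ell \<Lambda> k ! ((p + q) mod (n + 1)))"
proof -
  note dominant = weight_seq_dominant[OF assms(2,3,5)]
  have step: "weight_seq n i ell \<Lambda> (k + 1)
      = drop i (weight_seq n i ell \<Lambda> k) @ take i (weight_seq n i ell \<Lambda> k)" for k
  proof -
    have "length (weight_seq n i ell \<Lambda> k) = n + 1"
      using dominant[of k] by (simp add: dominant_weights_def)
    then show ?thesis
      using weight_seq_Suc_rotate[OF assms(2,3) dominant[of k]] assms(3)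
      by (simp add: rotate_drop_take del: weight_seq.simps)
  qed
  moreover have "min_elem n i ell (weight_seq n i ell \<Lambda> k) p q
      = weight_seq n i ell \<Lambda> k ! ((p + q) mod (n + 1))"
    if "1 \<le> p \<and> p \<le> i \<and> i \<le> q \<and> q \<le> n" for k p q
    using min_elem_eq[OF assms(2,3) dominant] that by (simp add: antidiagonal_array_def)
  ultimately show ?thesis
    using dominant minimal_element_ex1[OF assms(2,3) dominant] step[of 0]
    by (simp add: ground_state_path_def del: weight_seq.simps(2))
qed

end
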